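(* Let $L=\{0,+,-\}$ be the three-element monoid with identity $0$ and two left zeroes $+,-$. A left regular band $S$ belongs to the quasivariety $\mathrm{qv}(L)$ if and only if it satisfies the following condition (CC): for all $a,b\in S$ with $a\mathrel{\mathscr L}b$, if $a$ and $b$ are in the same connected component of the poset $S_{a,b}=\{s\in S\mid sa=sb\}$, then $a=b$.
   Context: A left regular band is a semigroup (not necessarily finite) satisfying the identities $x^2=x$ and $xyx=xy$. In $L$, the element $0$ is the identity and $xy=x$ for all $x\in\{+,-\}$ and $y\in L$. For a finite semigroup $T$, the quasivariety $\mathrm{qv}(T)$ generated by $T$ consists of all semigroups isomorphic to a subsemigroup of a (possibly infinite) direct power of $T$. For elements $a,b$ of a left regular band $S$, $a\mathrel{\mathscr L}b$ means $Sa=Sb$, equivalently $ab=a$ and $ba=b$. Every left regular band is a poset under $x\leq y\iff yx=x$; if $a\mathrel{\mathscr L}b$, the left ideal $S_{a,b}$ contains $a$ and $b$ and is given the restriction of this order. The connected components of a poset are the classes of the equivalence relation generated by $\leq$; thus $a,b$ are in the same component of $S_{a,b}$ iff there is a zig-zag $a=a_0\leq a_1\geq a_2\leq\cdots\geq a_n=b$ with all $a_i\in S_{a,b}$. *)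

theory Defs
  imports "HOL-Algebra.Product_Groups"
begin

(* A semigroup is represented by a record of type monoid_scheme of which only the fields carrier
   and mult are used; the field one is ignored (as it already is by hom, iso and \<cong>).
   The carrier may be empty, both here and in subsemigroup below. *)

locale left_regular_band =
  fixes S :: "('a, 'c) monoid_scheme" (structure)
  assumes m_closed: "x \<in> carrier S \<Longrightarrow> y \<in> carrier S \<Longrightarrow> x \<otimes> y \<in> carrier S"
    and m_assoc: "x \<in> carrier S \<Longrightarrow> y \<in> carrier S \<Longrightarrow> z \<in> carrier S
                   \<Longrightarrow> (x \<otimes> y) \<otimes> z = x \<otimes> (y \<otimes> z)"
    and idem: "x \<in> carrier S \<Longrightarrow> x \<otimes> x = x"
    and left_regular: "x \<in> carrier S \<Longrightarrow> y \<in> carrier S \<Longrightarrow> x \<otimes> y \<otimes> x = x \<otimes> y"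

definition L_rel :: "('a, 'c) monoid_scheme \<Rightarrow> 'a \<Rightarrow> 'a \<Rightarrow> bool" where
  "L_rel S a b \<longleftrightarrow> {s \<otimes>\<^bsub>S\<^esub> a | s. s \<in> carrier S} = {s \<otimes>\<^bsub>S\<^esub> b | s. s \<in> carrier S}"

definition lrb_le :: "('a, 'c) monoid_scheme \<Rightarrow> 'a \<Rightarrow> 'a \<Rightarrow> bool" where
  "lrb_le S x y \<longleftrightarrow> y \<otimes>\<^bsub>S\<^esub> x = x"

definition equalizer :: "('a, 'c) monoid_scheme \<Rightarrow> 'a \<Rightarrow> 'a \<Rightarrow> 'a set" where
  "equalizer S a b = {s \<in> carrier S. s \<otimes>\<^bsub>S\<^esub> a = s \<otimes>\<^bsub>S\<^esub> b}"

definition same_component :: "('a, 'c) monoid_scheme \<Rightarrow> 'a set \<Rightarrow> 'a \<Rightarrow> 'a \<Rightarrow> bool" where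
  "same_component S P x y \<longleftrightarrow>
     x \<in> P \<and> y \<in> P \<and> equivclp (\<lambda>u v. u \<in> P \<and> v \<in> P \<and> lrb_le S u v) x y"

definition CC :: "('a, 'c) monoid_scheme \<Rightarrow> bool" where
  "CC S \<longleftrightarrow> (\<forall>a \<in> carrier S. \<forall>b \<in> carrier S.
     L_rel S a b \<longrightarrow> same_component S (equalizer S a b) a b \<longrightarrow> a = b)"

datatype sign = Zero | Plus | Minus

fun sign_mult :: "sign \<Rightarrow> sign \<Rightarrow> sign" where
  "sign_mult Zero y = y"
| "sign_mult Plus y = Plus"
| "sign_mult Minus y = Minus"

definition L_monoid :: "sign monoid" where
  "L_monoid = \<lparr>carrier = UNIV, mult = sign_mult, one = Zero\<rparr>"

definition subsemigroup :: "'a set \<Rightarrow> ('a, 'c) monoid_scheme \<Rightarrow> bool" where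
  "subsemigroup H G \<longleftrightarrow> H \<subseteq> carrier G \<and> (\<forall>x \<in> H. \<forall>y \<in> H. x \<otimes>\<^bsub>G\<^esub> y \<in> H)"

(* product_group is the componentwise product of arbitrary monoid records, so
   product_group I (\<lambda>_. T) is the direct power of T with index set I. *)

definition embeds_in_power ::
  "'i itself \<Rightarrow> ('b, 'd) monoid_scheme \<Rightarrow> ('a, 'c) monoid_scheme \<Rightarrow> bool" where
  "embeds_in_power (_ :: 'i itself) T S \<longleftrightarrow>
     (\<exists>(I :: 'i set) H. subsemigroup H (product_group I (\<lambda>_. T)) \<and>
        S \<cong> (product_group I (\<lambda>_. T)) \<lparr>carrier := H\<rparr>)"

(* Membership in the quasivariety generated by a finite semigroup T. The index set of the power
   should be arbitrary, but HOL cannot quantify over types inside a formula. Index sets of maps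
   from S to T are no restriction: lemma in_qvI shows that an embedding into a power over an
   index set of any type yields one of this form. *)

definition in_qv :: "('b, 'd) monoid_scheme \<Rightarrow> ('a, 'c) monoid_scheme \<Rightarrow> bool" where
  "in_qv T S \<longleftrightarrow> embeds_in_power TYPE('a \<Rightarrow> 'b) T S"

lemma in_qvI:
  fixes S :: "('a, 'c) monoid_scheme" and T :: "('b, 'd) monoid_scheme"
  assumes closed: "\<And>x y. x \<in> carrier S \<Longrightarrow> y \<in> carrier S \<Longrightarrow> x \<otimes>\<^bsub>S\<^esub> y \<in> carrier S"
    and emb: "embeds_in_power TYPE('i) T S"
  shows "in_qv T S"
proof -
  from emb obtain I :: "'i set" and H f
    where H: "subsemigroup H (product_group I (\<lambda>_. T))"
      and f: "f \<in> iso S ((product_group I (\<lambda>_. T)) \<lparr>carrier := H\<rparr>)"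
    unfolding embeds_in_power_def is_iso_def by blast
  have f_car: "f x \<in> (\<Pi>\<^sub>E i\<in>I. carrier T)" if "x \<in> carrier S" for x
    using that f H by (fastforce simp: iso_def hom_def subsemigroup_def)
  have f_mult: "f (x \<otimes>\<^bsub>S\<^esub> y) = (\<lambda>i\<in>I. f x i \<otimes>\<^bsub>T\<^esub> f y i)"
    if "x \<in> carrier S" "y \<in> carrier S" for x y
    using that f by (simp add: iso_def hom_def)
  have f_inj: "inj_on f (carrier S)"
    using f by (simp add: iso_def bij_betw_def)
  let ?J = "hom S T"
  let ?P = "product_group ?J (\<lambda>_. T)"
  define g where "g x = (\<lambda>h\<in>?J. h x)" for x
  have proj: "(\<lambda>x. f x i) \<in> ?J" if "i \<in> I" for i
    using that f_car by (auto simp: hom_def f_mult PiE_iff)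
  have g_car: "g x \<in> carrier ?P" if "x \<in> carrier S" for x
    using that by (auto simp: g_def hom_def)
  have g_mult: "g (x \<otimes>\<^bsub>S\<^esub> y) = g x \<otimes>\<^bsub>?P\<^esub> g y" if "x \<in> carrier S" "y \<in> carrier S" for x y
    using that by (auto simp: g_def hom_def intro!: restrict_ext)
  have g_inj: "inj_on g (carrier S)"
  proof (rule inj_onI)
    fix x y assume xy: "x \<in> carrier S" "y \<in> carrier S" and eq: "g x = g y"
    have "f x i = f y i" if "i \<in> I" for i
      using fun_cong[OF eq, of "\<lambda>x. f x i"] proj[OF that] by (simp add: g_def)
    then have "f x = f y"
      using f_car xy by (metis PiE_ext)
    then show "x = y"
      using f_inj xy by (simp add: inj_on_eq_iff)
  qed
  have "subsemigroup (g ` carrier S) ?P"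
    unfolding subsemigroup_def using g_car g_mult[symmetric] closed by blast
  moreover have "g \<in> iso S (?P \<lparr>carrier := g ` carrier S\<rparr>)"
    using g_inj g_mult by (auto simp: iso_def hom_def bij_betw_def)
  ultimately show ?thesis
    unfolding in_qv_def embeds_in_power_def is_iso_def by blast
qed

end

(* Membership in qv(L) means that the homomorphisms into L separate points. A homomorphism into L
   that has no zero on S_{a,b} is constant on the components of S_{a,b}, while a zero at some s in
   S_{a,b} forces a and b to have the same image; this gives (CC).
   Conversely let a \<noteq> b. If a and b are not \<L>-related, the character vanishing exactly on
   {s. as = a} (or the same with b) separates them. If they are \<L>-related, Zorn's lemma gives a
   maximal filter U (a subsemigroup closed upwards in the \<L>-preorder) with ua \<noteq> ub for all u in U.
   Sending U to 0, and s outside U to + iff us and ua are in the same component of S_{ua,ub} for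
   some u in U, is a homomorphism; condition (CC) for the pairs (ua, ub) shows that b is sent to -.
   If ua = ub for all u, then S_{a,b} = S and no such U exists; the component of a is then sent to +
   and everything else to -. *)
theory Submission
  imports Defs
begin

section \<open>Quasivariety membership as separation of points\<close>

lemma in_qv_iff_separating:
  fixes S :: "('a, 'c) monoid_scheme" and T :: "('b, 'd) monoid_scheme"
  assumes closed: "\<And>x y. x \<in> carrier S \<Longrightarrow> y \<in> carrier S \<Longrightarrow> x \<otimes>\<^bsub>S\<^esub> y \<in> carrier S"
  shows "in_qv T S \<longleftrightarrow>
    (\<forall>x\<in>carrier S. \<forall>y\<in>carrier S. x \<noteq> y \<longrightarrow> (\<exists>h\<in>hom S T. h x \<noteq> h y))"
proof
  assume "in_qv T S"
  then obtain I :: "('a \<Rightarrow> 'b) set" and H f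
    where H: "subsemigroup H (product_group I (\<lambda>_. T))"
      and f: "f \<in> iso S ((product_group I (\<lambda>_. T)) \<lparr>carrier := H\<rparr>)"
    unfolding in_qv_def embeds_in_power_def is_iso_def by blast
  have f_car: "f x \<in> (\<Pi>\<^sub>E i\<in>I. carrier T)" if "x \<in> carrier S" for x
    using that f H by (fastforce simp: iso_def hom_def subsemigroup_def)
  have f_mult: "f (x \<otimes>\<^bsub>S\<^esub> y) = (\<lambda>i\<in>I. f x i \<otimes>\<^bsub>T\<^esub> f y i)"
    if "x \<in> carrier S" "y \<in> carrier S" for x y
    using that f by (simp add: iso_def hom_def)
  have proj: "(\<lambda>x. f x i) \<in> hom S T" if "i \<in> I" for i
    using that f_car by (auto simp: hom_def f_mult PiE_iff)
  have f_inj: "inj_on f (carrier S)"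
    using f by (simp add: iso_def bij_betw_def)
  show "\<forall>x\<in>carrier S. \<forall>y\<in>carrier S. x \<noteq> y \<longrightarrow> (\<exists>h\<in>hom S T. h x \<noteq> h y)"
  proof (intro ballI impI)
    fix x y assume xy: "x \<in> carrier S" "y \<in> carrier S" "x \<noteq> y"
    then have "f x \<noteq> f y"
      using f_inj by (auto dest: inj_onD)
    then obtain i where "i \<in> I" "f x i \<noteq> f y i"
      using f_car[OF xy(1)] f_car[OF xy(2)] by (meson PiE_ext)
    then show "\<exists>h\<in>hom S T. h x \<noteq> h y"
      by (intro bexI[OF _ proj])
  qed
next
  assume sep: "\<forall>x\<in>carrier S. \<forall>y\<in>carrier S. x \<noteq> y \<longrightarrow> (\<exists>h\<in>hom S T. h x \<noteq> h y)"
  let ?J = "hom S T"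
  let ?P = "product_group ?J (\<lambda>_. T)"
  \<comment> \<open>The evaluation map into the power indexed by all homomorphisms; it is injective
    exactly because they separate points.\<close>
  define g where "g x = (\<lambda>h\<in>?J. h x)" for x
  have g_car: "g x \<in> carrier ?P" if "x \<in> carrier S" for x
    using that by (auto simp: g_def hom_def)
  have g_mult: "g (x \<otimes>\<^bsub>S\<^esub> y) = g x \<otimes>\<^bsub>?P\<^esub> g y" if "x \<in> carrier S" "y \<in> carrier S" for x y
    using that by (auto simp: g_def hom_def intro!: restrict_ext)
  have g_inj: "inj_on g (carrier S)"
  proof (rule inj_onI)
    fix x y assume xy: "x \<in> carrier S" "y \<in> carrier S" and eq: "g x = g y"
    have "h x = h y" if "h \<in> ?J" for h
      using fun_cong[OF eq, of h] that by (simp add: g_def)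
    then show "x = y"
      using sep xy by blast
  qed
  have "subsemigroup (g ` carrier S) ?P"
    unfolding subsemigroup_def using g_car g_mult[symmetric] closed by blast
  moreover have "g \<in> iso S (?P \<lparr>carrier := g ` carrier S\<rparr>)"
    using g_inj g_mult by (auto simp: iso_def hom_def bij_betw_def)
  ultimately show "in_qv T S"
    unfolding in_qv_def embeds_in_power_def is_iso_def by blast
qed

section \<open>Zig-zags and connected components\<close>

lemma equivclp_map:
  assumes "equivclp r x y" and "\<And>x y. r x y \<Longrightarrow> r' (f x) (f y)"
  shows "equivclp r' (f x) (f y)"
  using assms(1)
proof (induction rule: equivclp_induct)
  case base
  then show ?case by simp
next
  case (step y z)
  then show ?case
    by (meson assms(2) equivclp_sym equivclp_trans r_into_equivclp)
qed

lemma same_component_refl: "x \<in> P \<Longrightarrow> same_component S P x x"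
  by (simp add: same_component_def)

lemma same_component_sym: "same_component S P x y \<Longrightarrow> same_component S P y x"
  by (auto simp: same_component_def intro: equivclp_sym)

lemma same_component_trans:
  "same_component S P x y \<Longrightarrow> same_component S P y z \<Longrightarrow> same_component S P x z"
  by (auto simp: same_component_def intro: equivclp_trans)

lemma same_component_le: "x \<in> P \<Longrightarrow> y \<in> P \<Longrightarrow> lrb_le S x y \<Longrightarrow> same_component S P x y"
  by (auto simp: same_component_def intro: r_into_equivclp)

text \<open>Needed for left translations, which carry zig-zags in one equalizer to zig-zags in
  another.\<close>

lemma same_component_map:
  assumes "same_component S P x y" and "\<And>x. x \<in> P \<Longrightarrow> f x \<in> Q"
    and "\<And>x y. x \<in> P \<Longrightarrow> y \<in> P \<Longrightarrow> lrb_le S x y \<Longrightarrow> lrb_le S (f x) (f y)"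
  shows "same_component S Q (f x) (f y)"
  using assms unfolding same_component_def by (auto elim!: equivclp_map)

section \<open>Homomorphisms into L and identities of left regular bands\<close>

lemma hom_L_monoid_iff:
  "h \<in> hom S L_monoid \<longleftrightarrow>
    (\<forall>x\<in>carrier S. \<forall>y\<in>carrier S. h (x \<otimes>\<^bsub>S\<^esub> y) = sign_mult (h x) (h y))"
  by (simp add: hom_def L_monoid_def)

lemma sign_mult_nonzero: "x \<noteq> Zero \<Longrightarrow> sign_mult x y = x"
  by (cases x) auto

context left_regular_band
begin

lemma left_idem: "x \<in> carrier S \<Longrightarrow> y \<in> carrier S \<Longrightarrow> x \<otimes> (x \<otimes> y) = x \<otimes> y"
  by (metis m_assoc idem)

lemma left_regular': "x \<in> carrier S \<Longrightarrow> y \<in> carrier S \<Longrightarrow> x \<otimes> (y \<otimes> x) = x \<otimes> y"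
  by (metis m_assoc left_regular)

lemma left_regular_left:
  "x \<in> carrier S \<Longrightarrow> y \<in> carrier S \<Longrightarrow> z \<in> carrier S \<Longrightarrow> x \<otimes> (y \<otimes> (x \<otimes> z)) = x \<otimes> (y \<otimes> z)"
  using arg_cong[OF left_regular[of x y], of "\<lambda>w. w \<otimes> z"] by (simp add: m_assoc m_closed)

lemma left_regular_nested:
  "x \<in> carrier S \<Longrightarrow> y \<in> carrier S \<Longrightarrow> z \<in> carrier S \<Longrightarrow> x \<otimes> (y \<otimes> (z \<otimes> x)) = x \<otimes> (y \<otimes> z)"
  using left_regular'[of x "y \<otimes> z"] by (simp add: m_assoc m_closed)

text \<open>In words associated to the right, these rules keep the first occurrence of a factor and
  delete later ones, as in the normal form of a free left regular band.\<close>

lemmas lrb_simps = m_closed m_assoc idem left_idem left_regular' left_regular_left left_regular_nested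

text \<open>By idempotence \<open>a\<close> lies in its own left ideal, so
  \<open>a = s \<otimes> b\<close> for some \<open>s\<close>, and a further right factor
  \<open>b\<close> is absorbed.\<close>

lemma L_rel_iff:
  assumes "a \<in> carrier S" "b \<in> carrier S"
  shows "L_rel S a b \<longleftrightarrow> a \<otimes> b = a \<and> b \<otimes> a = b"
proof
  assume L: "L_rel S a b"
  have "a \<otimes> a \<in> {s \<otimes> b | s. s \<in> carrier S}" "b \<otimes> b \<in> {s \<otimes> a | s. s \<in> carrier S}"
    using L assms unfolding L_rel_def by blast+
  then have "\<exists>s\<in>carrier S. a = s \<otimes> b" "\<exists>s\<in>carrier S. b = s \<otimes> a"
    using assms by (auto simp: idem)
  then show "a \<otimes> b = a \<and> b \<otimes> a = b"
    using assms by (metis m_assoc idem)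
next
  assume eq: "a \<otimes> b = a \<and> b \<otimes> a = b"
  have "s \<otimes> a = (s \<otimes> a) \<otimes> b" "s \<otimes> b = (s \<otimes> b) \<otimes> a" if "s \<in> carrier S" for s
    using that eq assms by (simp_all add: m_assoc)
  then show "L_rel S a b"
    unfolding L_rel_def using assms m_closed by blast
qed

section \<open>The order and the ideals S_{a,b}\<close>

lemma lrb_le_mult_right:
  "x \<in> carrier S \<Longrightarrow> y \<in> carrier S \<Longrightarrow> lrb_le S (x \<otimes> y) x"
  by (simp add: lrb_le_def left_idem)

lemma lrb_le_mult_left:
  "u \<in> carrier S \<Longrightarrow> x \<in> carrier S \<Longrightarrow> y \<in> carrier S \<Longrightarrow> lrb_le S x y
    \<Longrightarrow> lrb_le S (u \<otimes> x) (u \<otimes> y)"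
  by (simp add: lrb_le_def lrb_simps)

text \<open>Left regularity inserts a second \<open>s\<close>: sta = stsa = stsb = stb. So the
  evident left ideal S_{a,b} is a right ideal too.\<close>

lemma equalizer_mult_right:
  assumes ab: "a \<in> carrier S" "b \<in> carrier S"
    and s: "s \<in> equalizer S a b" and t: "t \<in> carrier S"
  shows "s \<otimes> t \<in> equalizer S a b"
proof -
  have sS: "s \<in> carrier S" and eq: "s \<otimes> a = s \<otimes> b"
    using s by (auto simp: equalizer_def)
  have "s \<otimes> (t \<otimes> (s \<otimes> a)) = s \<otimes> (t \<otimes> (s \<otimes> b))"
    by (simp only: eq)
  then show ?thesis
    using ab sS t by (simp add: equalizer_def lrb_simps)
qed

lemma equalizer_translate:
  assumes "a \<in> carrier S" "b \<in> carrier S" "u \<in> carrier S" "s \<in> equalizer S a b"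
  shows "s \<in> equalizer S (u \<otimes> a) (u \<otimes> b)"
  using equalizer_mult_right[OF assms(1,2,4,3)] assms by (simp add: equalizer_def m_assoc)

text \<open>The inner \<open>v\<close> is deleted by left regularity: vxvua = vxua = vxub =
  vxvub.\<close>

lemma equalizer_shift:
  assumes "a \<in> carrier S" "b \<in> carrier S" "u \<in> carrier S" "v \<in> carrier S"
    and "x \<in> equalizer S (u \<otimes> a) (u \<otimes> b)"
  shows "v \<otimes> x \<in> equalizer S (v \<otimes> u \<otimes> a) (v \<otimes> u \<otimes> b)"
  using assms by (simp add: equalizer_def lrb_simps)

section \<open>Necessity of (CC)\<close>

lemma hom_L_monoid_eq_on_component:
  assumes h: "h \<in> hom S L_monoid"
    and ab: "a \<in> carrier S" "b \<in> carrier S" "L_rel S a b"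
    and comp: "same_component S (equalizer S a b) a b"
  shows "h a = h b"
proof (cases "\<exists>s\<in>equalizer S a b. h s = Zero")
  case True
  then obtain s where "s \<in> carrier S" "s \<otimes> a = s \<otimes> b" "h s = Zero"
    by (auto simp: equalizer_def)
  \<comment> \<open>Since \<open>h s\<close> is the identity of L, h(a) = h(sa) = h(sb) =
    h(b).\<close>
  then show ?thesis
    using h ab unfolding hom_L_monoid_iff by (metis sign_mult.simps(1))
next
  case False
  have le: "h x = h y"
    if "x \<in> equalizer S a b" "y \<in> equalizer S a b" "lrb_le S x y" for x y
  proof -
    \<comment> \<open>Here yx = x, and the nonzero value \<open>h y\<close> is a left zero.\<close>
    have "h x = sign_mult (h y) (h x)"
      using that h by (metis (no_types, lifting) equalizer_def hom_L_monoid_iff lrb_le_def mem_Collect_eq)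
    then show ?thesis
      using False that by (simp add: sign_mult_nonzero)
  qed
  have "equivclp (=) (h a) (h b)"
    using comp unfolding same_component_def by (auto elim!: equivclp_map dest: le)
  then show ?thesis
    by (induction rule: equivclp_induct) auto
qed

section \<open>Characters and separating filters\<close>

lemma character_hom:
  assumes a: "a \<in> carrier S"
  shows "(\<lambda>s. if a \<otimes> s = a then Zero else Plus) \<in> hom S L_monoid"
proof -
  \<comment> \<open>Right factors \<open>x\<close> and \<open>y\<close> are absorbed by axy, where
    both already occur. Hence the zero set is a filter and its complement an ideal.\<close>
  have "a \<otimes> (x \<otimes> y) = a \<longleftrightarrow> a \<otimes> x = a \<and> a \<otimes> y = a"
    if "x \<in> carrier S" "y \<in> carrier S" for x y
  proof
    assume eq: "a \<otimes> (x \<otimes> y) = a"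
    have "a \<otimes> (x \<otimes> y) \<otimes> x = a \<otimes> (x \<otimes> y)" "a \<otimes> (x \<otimes> y) \<otimes> y = a \<otimes> (x \<otimes> y)"
      using a that by (simp_all add: lrb_simps)
    then show "a \<otimes> x = a \<and> a \<otimes> y = a"
      by (simp add: eq)
  next
    assume "a \<otimes> x = a \<and> a \<otimes> y = a"
    then show "a \<otimes> (x \<otimes> y) = a"
      using a that by (metis m_assoc)
  qed
  then show ?thesis
    by (simp add: hom_L_monoid_iff)
qed

text \<open>The condition \<open>u \<otimes> s = u\<close> puts \<open>s\<close> above
  \<open>u\<close> in the \<L>-preorder; the last clause makes \<open>U\<close> disjoint from the
  ideal \<open>equalizer S a b\<close>.\<close>

definition separating_filter :: "'a \<Rightarrow> 'a \<Rightarrow> 'a set \<Rightarrow> bool" where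
  "separating_filter a b U \<longleftrightarrow> U \<noteq> {} \<and> U \<subseteq> carrier S \<and>
     (\<forall>u\<in>U. \<forall>v\<in>U. u \<otimes> v \<in> U) \<and>
     (\<forall>u\<in>U. \<forall>s\<in>carrier S. u \<otimes> s = u \<longrightarrow> s \<in> U) \<and>
     (\<forall>u\<in>U. u \<otimes> a \<noteq> u \<otimes> b)"

text \<open>If us = u and sa = sb, then ua = usa = usb = ub. This filter gives Zorn's lemma a
  nonempty family.\<close>

lemma separating_filter_principal:
  assumes "a \<in> carrier S" "b \<in> carrier S" "u \<in> carrier S" "u \<otimes> a \<noteq> u \<otimes> b"
  shows "separating_filter a b {s \<in> carrier S. u \<otimes> s = u}"
  unfolding separating_filter_def
proof (intro conjI ballI impI)
  show "{s \<in> carrier S. u \<otimes> s = u} \<noteq> {}"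
    using assms idem by blast
next
  fix s t assume "s \<in> {s \<in> carrier S. u \<otimes> s = u}" "t \<in> {s \<in> carrier S. u \<otimes> s = u}"
  then show "s \<otimes> t \<in> {s \<in> carrier S. u \<otimes> s = u}"
    using assms by (auto simp: m_closed m_assoc[symmetric])
next
  fix s t assume "s \<in> {s \<in> carrier S. u \<otimes> s = u}" "t \<in> carrier S" "s \<otimes> t = s"
  then show "t \<in> {s \<in> carrier S. u \<otimes> s = u}"
    using assms by (metis (mono_tags, lifting) m_assoc mem_Collect_eq)
next
  fix s assume "s \<in> {s \<in> carrier S. u \<otimes> s = u}"
  then show "s \<otimes> a \<noteq> s \<otimes> b"
    using assms by (metis (mono_tags, lifting) m_assoc mem_Collect_eq)
qed auto

section \<open>Maximal separating filters by Zorn's lemma\<close>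

lemma separating_filter_Union:
  assumes "C \<noteq> {}" "subset.chain {U. separating_filter a b U} C"
  shows "separating_filter a b (\<Union>C)"
proof -
  have F: "separating_filter a b U" if "U \<in> C" for U
    using that assms by (auto simp: subset_chain_def)
  have mult: "u \<otimes> v \<in> \<Union>C" if "u \<in> \<Union>C" "v \<in> \<Union>C" for u v
  proof -
    obtain U V where UV: "U \<in> C" "V \<in> C" "u \<in> U" "v \<in> V"
      using \<open>u \<in> \<Union>C\<close> \<open>v \<in> \<Union>C\<close> by blast
    then have "U \<subseteq> V \<or> V \<subseteq> U"
      using assms(2) unfolding subset_chain_def by blast
    then obtain W where "W \<in> C" "u \<in> W" "v \<in> W"
      using UV by blast
    then show ?thesis
      using F unfolding separating_filter_def by blast
  qed
  have "\<Union>C \<noteq> {}" "\<Union>C \<subseteq> carrier S"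
    using assms(1) F unfolding separating_filter_def by blast+
  then show ?thesis
    using mult F unfolding separating_filter_def by (intro conjI) blast+
qed

text \<open>\<open>V\<close> is the filter generated by \<open>U\<close> and \<open>s\<close>: all
  elements above some us with \<open>u\<close> in \<open>U\<close>. Assumption \<open>sep\<close>
  keeps these generators out of S_{a,b}.\<close>

lemma separating_filter_adjoin:
  assumes ab: "a \<in> carrier S" "b \<in> carrier S"
    and U: "separating_filter a b U" and s: "s \<in> carrier S"
    and sep: "\<forall>u\<in>U. u \<otimes> s \<otimes> a \<noteq> u \<otimes> s \<otimes> b"
  defines "V \<equiv> {t \<in> carrier S. \<exists>u\<in>U. u \<otimes> s \<otimes> t = u \<otimes> s}"
  shows "separating_filter a b V" and "U \<subseteq> V" and "s \<in> V"
proof -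
  have US: "U \<subseteq> carrier S"
    using U by (simp add: separating_filter_def)
  show UV: "U \<subseteq> V"
  proof
    fix u assume "u \<in> U"
    moreover from this US s have "u \<otimes> s \<otimes> u = u \<otimes> s"
      by (auto intro: left_regular)
    ultimately show "u \<in> V"
      using US unfolding V_def by blast
  qed
  obtain u0 where "u0 \<in> U"
    using U by (auto simp: separating_filter_def)
  moreover from this US s have "u0 \<otimes> s \<otimes> s = u0 \<otimes> s"
    by (auto simp: lrb_simps)
  ultimately show "s \<in> V"
    using s unfolding V_def by blast
  show "separating_filter a b V"
    unfolding separating_filter_def
  proof (intro conjI ballI impI)
    show "V \<noteq> {}"
      using UV \<open>u0 \<in> U\<close> by blast
    show "V \<subseteq> carrier S"
      by (auto simp: V_def)
  next
    fix t t' assume "t \<in> V" "t' \<in> V"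
    then obtain u u' where t: "t \<in> carrier S" "u \<in> U" "u \<otimes> s \<otimes> t = u \<otimes> s"
      and t': "t' \<in> carrier S" "u' \<in> U" "u' \<otimes> s \<otimes> t' = u' \<otimes> s"
      unfolding V_def by blast
    have uS: "u \<in> carrier S" "u' \<in> carrier S"
      using US t t' by auto
    \<comment> \<open>A common lower bound of us and u's in the \<L>-preorder, so it absorbs both
      \<open>t\<close> and \<open>t'\<close> on the right; its prefix uu' is again in
      \<open>U\<close>.\<close>
    let ?w = "u \<otimes> u' \<otimes> s"
    have w: "?w \<in> carrier S" "?w \<otimes> (u \<otimes> s) = ?w"
      using uS s by (simp_all add: lrb_simps)
    have "?w \<otimes> t = ?w \<otimes> (u \<otimes> s \<otimes> t)"
      using w uS s t(1) by (metis m_assoc m_closed)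
    then have "?w \<otimes> t = ?w"
      using w t by simp
    moreover have "?w \<otimes> t' = u \<otimes> (u' \<otimes> s \<otimes> t')"
      using uS s t'(1) by (simp add: m_assoc m_closed)
    then have "?w \<otimes> t' = ?w"
      using uS s t' by (simp add: m_assoc)
    ultimately have "?w \<otimes> (t \<otimes> t') = ?w"
      using w t t' by (metis m_assoc)
    moreover have "u \<otimes> u' \<in> U"
      using U t t' by (auto simp: separating_filter_def)
    ultimately show "t \<otimes> t' \<in> V"
      using t t' m_closed unfolding V_def by blast
  next
    fix t r assume "t \<in> V" "r \<in> carrier S" "t \<otimes> r = t"
    then obtain u where t: "t \<in> carrier S" "u \<in> U" "u \<otimes> s \<otimes> t = u \<otimes> s"
      unfolding V_def by blast
    then have "u \<otimes> s \<otimes> r = u \<otimes> s"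
      using \<open>r \<in> carrier S\<close> \<open>t \<otimes> r = t\<close> m_assoc[of "u \<otimes> s" t r] US s by (auto simp: m_closed)
    then show "r \<in> V"
      using t \<open>r \<in> carrier S\<close> unfolding V_def by blast
  next
    fix t assume "t \<in> V"
    then obtain u where t: "t \<in> carrier S" "u \<in> U" "u \<otimes> s \<otimes> t = u \<otimes> s"
      unfolding V_def by blast
    moreover have uS: "u \<otimes> s \<in> carrier S"
      using t US s m_closed by blast
    \<comment> \<open>Thus ta = tb would force usa = usb, against \<open>sep\<close>.\<close>
    ultimately have "u \<otimes> s \<otimes> (t \<otimes> a) = u \<otimes> s \<otimes> a" "u \<otimes> s \<otimes> (t \<otimes> b) = u \<otimes> s \<otimes> b"
      using ab by (simp_all flip: m_assoc)
    then show "t \<otimes> a \<noteq> t \<otimes> b"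
      using sep t by metis
  qed
qed

text \<open>Maximality enters only in this form: if no vs with \<open>v\<close> in \<open>U\<close>
  lay in S_{a,b}, adjoining \<open>s\<close> would enlarge \<open>U\<close>.\<close>

lemma maximal_separating_filter:
  assumes ab: "a \<in> carrier S" "b \<in> carrier S"
    and u: "u \<in> carrier S" "u \<otimes> a \<noteq> u \<otimes> b"
  obtains U where "separating_filter a b U"
    and "\<And>s. s \<in> carrier S \<Longrightarrow> s \<notin> U \<Longrightarrow> \<exists>v\<in>U. v \<otimes> s \<otimes> a = v \<otimes> s \<otimes> b"
proof -
  have "\<exists>M\<in>{U. separating_filter a b U}. \<forall>X\<in>{U. separating_filter a b U}. M \<subseteq> X \<longrightarrow> X = M"
  proof (rule subset_Zorn_nonempty)
    show "{U. separating_filter a b U} \<noteq> {}"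
      using separating_filter_principal[OF ab u] by blast
    show "\<Union>C \<in> {U. separating_filter a b U}"
      if "C \<noteq> {}" "subset.chain {U. separating_filter a b U} C" for C
      using separating_filter_Union[OF that] by simp
  qed
  then obtain U where U: "separating_filter a b U"
    and max: "\<And>X. separating_filter a b X \<Longrightarrow> U \<subseteq> X \<Longrightarrow> X = U"
    by blast
  have "\<exists>v\<in>U. v \<otimes> s \<otimes> a = v \<otimes> s \<otimes> b" if "s \<in> carrier S" "s \<notin> U" for s
    using separating_filter_adjoin[OF ab U \<open>s \<in> carrier S\<close>] max that by blast
  with U show ?thesis
    by (rule that)
qed

section \<open>Sufficiency of (CC)\<close>

lemma CC_D:
  assumes "CC S" "a \<in> carrier S" "b \<in> carrier S" "a \<otimes> b = a" "b \<otimes> a = b"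
    and "same_component S (equalizer S a b) a b"
  shows "a = b"
  using assms L_rel_iff unfolding CC_def by blast

text \<open>Components of S are right ideals because xy \<le> x, so a map to the left zeros that is
  constant on components is a homomorphism.\<close>

lemma separating_hom_left_zero:
  assumes "CC S" and ab: "a \<in> carrier S" "b \<in> carrier S" "a \<otimes> b = a" "b \<otimes> a = b" "a \<noteq> b"
    and all: "\<And>u. u \<in> carrier S \<Longrightarrow> u \<otimes> a = u \<otimes> b"
  shows "\<exists>h\<in>hom S L_monoid. h a \<noteq> h b"
proof -
  have eq: "equalizer S a b = carrier S"
    using all by (auto simp: equalizer_def)
  define h where "h s = (if same_component S (carrier S) s a then Plus else Minus)" for s
  have "same_component S (carrier S) (x \<otimes> y) x" if "x \<in> carrier S" "y \<in> carrier S" for x y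
    using that by (simp add: same_component_le lrb_le_mult_right m_closed)
  then have "h (x \<otimes> y) = h x" if "x \<in> carrier S" "y \<in> carrier S" for x y
    using that unfolding h_def by (meson same_component_sym same_component_trans)
  then have "h \<in> hom S L_monoid"
    by (simp add: hom_L_monoid_iff h_def)
  moreover have "\<not> same_component S (carrier S) b a"
    using CC_D[OF assms(1) ab(1-4)] ab(5) unfolding eq by (blast dest: same_component_sym)
  then have "h a \<noteq> h b"
    using ab by (simp add: h_def same_component_refl)
  ultimately show ?thesis
    by blast
qed

lemma separating_hom_filter:
  assumes "CC S" and ab: "a \<in> carrier S" "b \<in> carrier S" "a \<otimes> b = a" "b \<otimes> a = b"
    and U: "separating_filter a b U"
    and max: "\<And>s. s \<in> carrier S \<Longrightarrow> s \<notin> U \<Longrightarrow> \<exists>v\<in>U. v \<otimes> s \<otimes> a = v \<otimes> s \<otimes> b"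
  shows "\<exists>h\<in>hom S L_monoid. h a \<noteq> h b"
proof -
  let ?E = "\<lambda>u. equalizer S (u \<otimes> a) (u \<otimes> b)"
  \<comment> \<open>\<open>P u s\<close> includes the membership of us in \<open>?E u\<close>, since
    \<open>same_component\<close> requires both points to lie in the set.\<close>
  define P where "P u s \<longleftrightarrow> same_component S (?E u) (u \<otimes> s) (u \<otimes> a)" for u s
  define h where "h s = (if s \<in> U then Zero else if \<exists>u\<in>U. P u s then Plus else Minus)" for s
  have US: "u \<in> carrier S" if "u \<in> U" for u
    using U that by (auto simp: separating_filter_def)
  have U_mult: "u \<otimes> v \<in> U" if "u \<in> U" "v \<in> U" for u v
    using U that by (auto simp: separating_filter_def)
  have U_up: "s \<in> U" if "u \<in> U" "s \<in> carrier S" "u \<otimes> s = u" for u s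
    using U that by (auto simp: separating_filter_def)
  \<comment> \<open>The product st absorbs both \<open>s\<close> and \<open>t\<close> on the right,
    so it lies below each of them.\<close>
  have U_iff: "s \<otimes> t \<in> U \<longleftrightarrow> s \<in> U \<and> t \<in> U" if "s \<in> carrier S" "t \<in> carrier S" for s t
    using U_mult U_up[of "s \<otimes> t" s] U_up[of "s \<otimes> t" t] that by (auto simp: lrb_simps)
  have a_E: "u \<otimes> a \<in> ?E u" if "u \<in> carrier S" for u
    using that ab by (simp add: equalizer_def lrb_simps)
  \<comment> \<open>Left translation by \<open>v\<close> is monotone and maps \<open>?E u\<close>
    into \<open>?E (v \<otimes> u)\<close>, so it carries the zig-zag along.\<close>
  have P_left: "P (v \<otimes> u) s" if "P u s" "u \<in> U" "v \<in> U" "s \<in> carrier S" for u v s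
  proof -
    have "same_component S (?E (v \<otimes> u)) (v \<otimes> (u \<otimes> s)) (v \<otimes> (u \<otimes> a))"
    proof (rule same_component_map[where P = "?E u" and f = "\<lambda>x. v \<otimes> x"])
      show "same_component S (?E u) (u \<otimes> s) (u \<otimes> a)"
        using that by (simp add: P_def)
      show "v \<otimes> x \<in> ?E (v \<otimes> u)" if "x \<in> ?E u" for x
        using that \<open>u \<in> U\<close> \<open>v \<in> U\<close> US ab by (blast intro: equalizer_shift)
      show "lrb_le S (v \<otimes> x) (v \<otimes> y)" if "x \<in> ?E u" "y \<in> ?E u" "lrb_le S x y" for x y
        using that \<open>v \<in> U\<close> US by (auto simp: equalizer_def intro: lrb_le_mult_left)
    qed
    then show ?thesis
      using that US ab by (simp add: P_def m_assoc)
  qed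
  have P_right: "P (u \<otimes> v) s" if "P u s" "u \<in> U" "v \<in> U" "s \<in> carrier S" for u v s
  proof -
    \<comment> \<open>Translating by \<open>v\<close> and then by \<open>u\<close> reaches uvu =
      uv.\<close>
    have "P (u \<otimes> (v \<otimes> u)) s"
      using that by (simp add: P_left U_mult)
    then show ?thesis
      using that US by (simp add: left_regular')
  qed
  have P_ideal: "(\<exists>u\<in>U. P u (s \<otimes> t)) \<longleftrightarrow> (\<exists>u\<in>U. P u s)"
    if s: "s \<in> carrier S" "s \<notin> U" and t: "t \<in> carrier S" for s t
  proof -
    \<comment> \<open>The ideal \<open>?E u\<close> contains ust along with us, and ust \<le>
      us.\<close>
    have step: "same_component S (?E u) (u \<otimes> (s \<otimes> t)) (u \<otimes> s)"
      if "u \<in> U" "u \<otimes> s \<in> ?E u" for u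
    proof -
      have "u \<otimes> s \<otimes> t \<in> ?E u"
        using that ab t US by (simp add: equalizer_mult_right m_closed)
      then show ?thesis
        using that s t US lrb_le_mult_right[of "u \<otimes> s" t]
        by (auto simp: m_assoc m_closed intro: same_component_le)
    qed
    show ?thesis
    proof
      assume "\<exists>u\<in>U. P u (s \<otimes> t)"
      then obtain u where u: "u \<in> U" "P u (s \<otimes> t)" ..
      \<comment> \<open>The point us need not lie in \<open>?E u\<close>. Maximality gives
        \<open>v\<close> with vs in S_{a,b}; then uvs lies in S_{a,b}, hence in
        \<open>?E (u \<otimes> v)\<close>, while \<open>P_right\<close> preserves the relation for
        st.\<close>
      obtain v where v: "v \<in> U" "v \<otimes> s \<otimes> a = v \<otimes> s \<otimes> b"
        using max s by blast
      have uv: "u \<otimes> v \<in> U" "P (u \<otimes> v) (s \<otimes> t)"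
        using u v s t by (simp_all add: U_mult P_right m_closed)
      have "u \<otimes> v \<otimes> s \<in> equalizer S a b"
        using arg_cong[OF v(2), of "\<lambda>x. u \<otimes> x"] u v s ab US
        by (simp add: equalizer_def m_assoc m_closed)
      then have "u \<otimes> v \<otimes> s \<in> ?E (u \<otimes> v)"
        using uv US ab by (intro equalizer_translate)
      then have "P (u \<otimes> v) s"
        using step uv unfolding P_def by (meson same_component_sym same_component_trans)
      with uv show "\<exists>u\<in>U. P u s" by blast
    next
      assume "\<exists>u\<in>U. P u s"
      then show "\<exists>u\<in>U. P u (s \<otimes> t)"
        using step unfolding P_def by (meson same_component_def same_component_trans)
    qed
  qed
  have P_unit: "(\<exists>u\<in>U. P u (s \<otimes> t)) \<longleftrightarrow> (\<exists>u\<in>U. P u t)"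
    if s: "s \<in> U" and t: "t \<in> carrier S" for s t
  proof -
    \<comment> \<open>With us in place of \<open>u\<close>, the leading \<open>s\<close> of st is
      absorbed. \<open>P_right\<close> moves any witness \<open>u\<close> to us.\<close>
    have "P (u \<otimes> s) (s \<otimes> t) \<longleftrightarrow> P (u \<otimes> s) t" if "u \<in> U" for u
      using that s t US by (simp add: P_def lrb_simps)
    then show ?thesis
      using s t US U_mult P_right m_closed by metis
  qed
  have "h (s \<otimes> t) = sign_mult (h s) (h t)" if "s \<in> carrier S" "t \<in> carrier S" for s t
    using that P_ideal[of s t] P_unit[of s t] U_iff[of s t] by (auto simp: h_def)
  then have "h \<in> hom S L_monoid"
    by (simp add: hom_L_monoid_iff)
  moreover have "h a \<noteq> h b"
  proof -
    \<comment> \<open>Idempotence gives aa = a = ab and ba = b = bb, so both elements lie in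
      S_{a,b}.\<close>
    have "a \<notin> U" "b \<notin> U"
      using U ab idem unfolding separating_filter_def by metis+
    moreover obtain u where "u \<in> U"
      using U by (auto simp: separating_filter_def)
    then have "P u a"
      using US a_E by (simp add: P_def same_component_refl)
    moreover have "\<not> P v b" if "v \<in> U" for v
    proof
      assume "P v b"
      then have "same_component S (?E v) (v \<otimes> a) (v \<otimes> b)"
        by (simp add: P_def same_component_sym)
      \<comment> \<open>The pair va, vb is again \<L>-related, and \<open>?E v\<close> is its
        equalizer, so (CC) applies.\<close>
      then have "v \<otimes> a = v \<otimes> b"
        by (rule CC_D[OF \<open>CC S\<close>, rotated 4])
          (use that US ab in \<open>simp_all add: lrb_simps\<close>)
      then show False
        using U that by (auto simp: separating_filter_def)
    qed
    ultimately show ?thesis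
      using \<open>u \<in> U\<close> by (auto simp: h_def)
  qed
  ultimately show ?thesis
    by blast
qed

lemma CC_imp_separating_hom:
  assumes "CC S" and ab: "a \<in> carrier S" "b \<in> carrier S" "a \<noteq> b"
  shows "\<exists>h\<in>hom S L_monoid. h a \<noteq> h b"
proof -
  consider "a \<otimes> b \<noteq> a" | "b \<otimes> a \<noteq> b" | "a \<otimes> b = a" "b \<otimes> a = b"
    by blast
  then show ?thesis
  proof cases
    case 1
    \<comment> \<open>The character of \<open>a\<close> is \<open>Zero\<close> at \<open>a\<close>
      and \<open>Plus\<close> at \<open>b\<close>.\<close>
    then show ?thesis
      using ab idem by (intro bexI[OF _ character_hom[OF ab(1)]]) auto
  next
    case 2
    then show ?thesis
      using ab idem by (intro bexI[OF _ character_hom[OF ab(2)]]) auto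
  next
    case 3
    show ?thesis
    proof (cases "\<exists>u\<in>carrier S. u \<otimes> a \<noteq> u \<otimes> b")
      case True
      then obtain U where "separating_filter a b U"
        and "\<And>s. s \<in> carrier S \<Longrightarrow> s \<notin> U \<Longrightarrow> \<exists>v\<in>U. v \<otimes> s \<otimes> a = v \<otimes> s \<otimes> b"
        using maximal_separating_filter[OF ab(1,2)] by blast
      then show ?thesis
        by (rule separating_hom_filter[OF assms(1) ab(1,2) 3])
    next
      case False
      then show ?thesis
        using 3 assms by (intro separating_hom_left_zero) auto
    qed
  qed
qed

end

theorem theorem6:
  fixes S :: "('a, 'c) monoid_scheme"
  assumes "left_regular_band S"
  shows "in_qv L_monoid S \<longleftrightarrow> CC S"
proof -
  interpret left_regular_band S by fact
  have "in_qv L_monoid S \<longleftrightarrow>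
    (\<forall>x\<in>carrier S. \<forall>y\<in>carrier S. x \<noteq> y \<longrightarrow> (\<exists>h\<in>hom S L_monoid. h x \<noteq> h y))"
    by (rule in_qv_iff_separating) (rule m_closed)
  also have "\<dots> \<longleftrightarrow> CC S"
    using CC_imp_separating_hom hom_L_monoid_eq_on_component
    unfolding CC_def[of S] by meson
  finally show ?thesis .
qed

end
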